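(* Let $c>1$, $G=\,]-c,-1[\,\cup\,]1,c[\,\subset\mathbb{R}$, and let $g,h$ be real $C^\infty$ functions on $\mathbb{R}$ such that $g(x)>0$ for $x\in G$, $g(x)=0$ for $x\notin G$, $g(y)=g(-y)$ for all $y$, $h(y)=-g(y)$ for $y>1$, $h(y)=g(y)$ for $y<-1$, and $h(y)=0$ for $|y|\le1$. On the Hilbert space $L^2(G)$ let $H=\Omega+|g\rangle\langle h|$. Then the operator $H$ is not normal, i.e. $HH^*\neq H^*H$.
   Context: $\Omega$ is the multiplication operator $(\Omega f)(y)=yf(y)$ on $L^2(G)$, and $|g\rangle\langle h|$ is the rank one operator $f\mapsto g\,\langle h|f\rangle=g\int_Gh(\omega)f(\omega)\,d\omega$. *)

theory Defs
  imports "HOL-Analysis.Analysis"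
begin

section \<open>The complex Hilbert space of square-integrable functions modulo null sets\<close>

definition sq_integrable :: "'a measure \<Rightarrow> ('a \<Rightarrow> complex) set" where
  "sq_integrable M =
     {f. f \<in> borel_measurable M \<and> integrable M (\<lambda>x. (cmod (f x))\<^sup>2)}"

definition ae_eq_rel :: "'a measure \<Rightarrow> (('a \<Rightarrow> complex) \<times> ('a \<Rightarrow> complex)) set" where
  "ae_eq_rel M =
     {(f, g). f \<in> sq_integrable M \<and> g \<in> sq_integrable M \<and> (AE x in M. f x = g x)}"

text \<open>
  Elements of the space are equivalence classes of functions on the whole type; the values of
  a representative outside \<^term>\<open>space M\<close> are irrelevant, since the almost-everywhere quantifier
  only ranges over \<^term>\<open>space M\<close>.
\<close>

definition L2 :: "'a measure \<Rightarrow> ('a \<Rightarrow> complex) set set" where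
  "L2 M = sq_integrable M // ae_eq_rel M"

definition L2_class :: "'a measure \<Rightarrow> ('a \<Rightarrow> complex) \<Rightarrow> ('a \<Rightarrow> complex) set" where
  "L2_class M f = ae_eq_rel M `` {f}"

definition rep :: "('a \<Rightarrow> complex) set \<Rightarrow> 'a \<Rightarrow> complex" where
  "rep F = (SOME f. f \<in> F)"

definition L2_add ::
  "'a measure \<Rightarrow> ('a \<Rightarrow> complex) set \<Rightarrow> ('a \<Rightarrow> complex) set \<Rightarrow> ('a \<Rightarrow> complex) set" where
  "L2_add M F G = L2_class M (\<lambda>x. rep F x + rep G x)"

definition L2_scale ::
  "'a measure \<Rightarrow> complex \<Rightarrow> ('a \<Rightarrow> complex) set \<Rightarrow> ('a \<Rightarrow> complex) set" where
  "L2_scale M a F = L2_class M (\<lambda>x. a * rep F x)"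

text \<open>Conjugate-linear in the first argument, as in the bra-ket convention.\<close>

definition L2_inner ::
  "'a measure \<Rightarrow> ('a \<Rightarrow> complex) set \<Rightarrow> ('a \<Rightarrow> complex) set \<Rightarrow> complex" where
  "L2_inner M F G = (LINT x|M. cnj (rep F x) * rep G x)"

section \<open>Operators\<close>

text \<open>
  Everywhere-defined operators are extensional functions on \<^term>\<open>L2 M\<close>, so that equality of
  operators is equality of functions.
\<close>

definition mult_op ::
  "'a measure \<Rightarrow> ('a \<Rightarrow> complex) \<Rightarrow> ('a \<Rightarrow> complex) set \<Rightarrow> ('a \<Rightarrow> complex) set" where
  "mult_op M \<phi> = (\<lambda>F\<in>L2 M. L2_class M (\<lambda>x. \<phi> x * rep F x))"

definition ketbra ::
  "'a measure \<Rightarrow> ('a \<Rightarrow> complex) set \<Rightarrow> ('a \<Rightarrow> complex) set \<Rightarrow>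
     ('a \<Rightarrow> complex) set \<Rightarrow> ('a \<Rightarrow> complex) set" where
  "ketbra M U V = (\<lambda>F\<in>L2 M. L2_scale M (L2_inner M V F) U)"

definition op_add ::
  "'a measure \<Rightarrow> (('a \<Rightarrow> complex) set \<Rightarrow> ('a \<Rightarrow> complex) set) \<Rightarrow>
     (('a \<Rightarrow> complex) set \<Rightarrow> ('a \<Rightarrow> complex) set) \<Rightarrow>
     ('a \<Rightarrow> complex) set \<Rightarrow> ('a \<Rightarrow> complex) set" where
  "op_add M A B = (\<lambda>F\<in>L2 M. L2_add M (A F) (B F))"

definition is_adjoint ::
  "'a measure \<Rightarrow> (('a \<Rightarrow> complex) set \<Rightarrow> ('a \<Rightarrow> complex) set) \<Rightarrow>
     (('a \<Rightarrow> complex) set \<Rightarrow> ('a \<Rightarrow> complex) set) \<Rightarrow> bool" where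
  "is_adjoint M A B \<longleftrightarrow>
     B \<in> L2 M \<rightarrow>\<^sub>E L2 M \<and>
     (\<forall>F\<in>L2 M. \<forall>G\<in>L2 M. L2_inner M (B F) G = L2_inner M F (A G))"

definition L2_adjoint ::
  "'a measure \<Rightarrow> (('a \<Rightarrow> complex) set \<Rightarrow> ('a \<Rightarrow> complex) set) \<Rightarrow>
     ('a \<Rightarrow> complex) set \<Rightarrow> ('a \<Rightarrow> complex) set" where
  "L2_adjoint M A = (THE B. is_adjoint M A B)"

definition normal_op ::
  "'a measure \<Rightarrow> (('a \<Rightarrow> complex) set \<Rightarrow> ('a \<Rightarrow> complex) set) \<Rightarrow> bool" where
  "normal_op M A \<longleftrightarrow>
     compose (L2 M) A (L2_adjoint M A) = compose (L2 M) (L2_adjoint M A) A"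

section \<open>Smooth real functions\<close>

definition smooth :: "(real \<Rightarrow> real) \<Rightarrow> bool" where
  "smooth f \<longleftrightarrow> (\<forall>n x. (deriv ^^ n) f differentiable (at x))"

section \<open>Independence of representatives and uniqueness of adjoints\<close>

lemma equiv_ae_eq_rel: "equiv (sq_integrable M) (ae_eq_rel M)"
proof (rule equivI)
  show "ae_eq_rel M \<subseteq> sq_integrable M \<times> sq_integrable M"
    by (auto simp: ae_eq_rel_def)
  show "refl_on (sq_integrable M) (ae_eq_rel M)"
    by (auto simp: ae_eq_rel_def refl_on_def)
  show "sym (ae_eq_rel M)"
    by (auto simp: ae_eq_rel_def sym_def elim: AE_mp)
  show "trans (ae_eq_rel M)"
    unfolding ae_eq_rel_def trans_def by (auto elim!: AE_mp)
qed

lemma L2_class_in_L2: "f \<in> sq_integrable M \<Longrightarrow> L2_class M f \<in> L2 M"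
  by (simp add: L2_class_def L2_def quotientI)

lemma rep_in_class:
  assumes "F \<in> L2 M"
  shows "rep F \<in> F"
  using assms in_quotient_imp_non_empty[OF equiv_ae_eq_rel]
  unfolding L2_def rep_def by (metis some_in_eq)

lemma rep_sq_integrable: "F \<in> L2 M \<Longrightarrow> rep F \<in> sq_integrable M"
  using rep_in_class in_quotient_imp_subset[OF equiv_ae_eq_rel] unfolding L2_def by blast

lemma L2_class_rep: "F \<in> L2 M \<Longrightarrow> L2_class M (rep F) = F"
  using rep_in_class[of F M] unfolding L2_def L2_class_def
  by (metis (no_types) Image_singleton_iff equiv_ae_eq_rel equiv_class_eq quotientE)

lemma L2_class_eq_iff:
  assumes "f \<in> sq_integrable M" "g \<in> sq_integrable M"
  shows "L2_class M f = L2_class M g \<longleftrightarrow> (AE x in M. f x = g x)"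
  using eq_equiv_class_iff[OF equiv_ae_eq_rel assms] assms
  by (auto simp: L2_class_def ae_eq_rel_def)

lemma AE_rep_L2_class:
  assumes "f \<in> sq_integrable M"
  shows "AE x in M. rep (L2_class M f) x = f x"
  using L2_class_eq_iff[OF rep_sq_integrable[OF L2_class_in_L2[OF assms]] assms]
    L2_class_rep[OF L2_class_in_L2[OF assms]] by simp

lemma sq_integrable_cong:
  assumes "f \<in> sq_integrable M" "g \<in> borel_measurable M" "AE x in M. g x = f x"
  shows "g \<in> sq_integrable M"
proof -
  have [measurable]: "f \<in> borel_measurable M" "g \<in> borel_measurable M"
    using assms by (auto simp: sq_integrable_def)
  have "integrable M (\<lambda>x. (cmod (g x))\<^sup>2) \<longleftrightarrow> integrable M (\<lambda>x. (cmod (f x))\<^sup>2)"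
    using assms(3) by (intro integrable_cong_AE) (auto elim!: AE_mp)
  then show ?thesis using assms by (auto simp: sq_integrable_def)
qed

lemma sq_integrable_mult_cnj:
  assumes "f \<in> sq_integrable M" "g \<in> sq_integrable M"
  shows "integrable M (\<lambda>x. cnj (f x) * g x)"
proof (rule Bochner_Integration.integrable_bound)
  show "integrable M (\<lambda>x. (cmod (f x))\<^sup>2 + (cmod (g x))\<^sup>2)"
    using assms by (auto simp: sq_integrable_def)
  have [measurable]: "f \<in> borel_measurable M" "g \<in> borel_measurable M"
    using assms by (auto simp: sq_integrable_def)
  have [measurable]: "cnj \<in> borel_measurable borel"
    by (intro borel_measurable_continuous_onI continuous_intros)
  show "(\<lambda>x. cnj (f x) * g x) \<in> borel_measurable M" by measurable
  have "a * b \<le> a\<^sup>2 + b\<^sup>2" if "0 \<le> a" "0 \<le> b" for a b :: real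
    using sum_squares_bound[of a b] that mult_nonneg_nonneg[OF that] by linarith
  then show "AE x in M. norm (cnj (f x) * g x) \<le> norm ((cmod (f x))\<^sup>2 + (cmod (g x))\<^sup>2)"
    by (auto simp: norm_mult)
qed

lemma sq_integrable_add:
  assumes "f \<in> sq_integrable M" "g \<in> sq_integrable M"
  shows "(\<lambda>x. f x + g x) \<in> sq_integrable M"
proof -
  have [measurable]: "f \<in> borel_measurable M" "g \<in> borel_measurable M"
    using assms by (auto simp: sq_integrable_def)
  have "integrable M (\<lambda>x. (cmod (f x + g x))\<^sup>2)"
  proof (rule Bochner_Integration.integrable_bound)
    show "integrable M (\<lambda>x. 2 * (cmod (f x))\<^sup>2 + 2 * (cmod (g x))\<^sup>2)"
      using assms by (auto simp: sq_integrable_def)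
    have "(cmod (a + b))\<^sup>2 \<le> 2 * (cmod a)\<^sup>2 + 2 * (cmod b)\<^sup>2" for a b
    proof -
      have "(cmod (a + b))\<^sup>2 \<le> (cmod a + cmod b)\<^sup>2"
        by (intro power_mono norm_triangle_ineq) auto
      also have "\<dots> \<le> 2 * (cmod a)\<^sup>2 + 2 * (cmod b)\<^sup>2"
        using sum_squares_bound[of "cmod a" "cmod b"] by (simp add: power2_sum)
      finally show ?thesis .
    qed
    then show "AE x in M. norm ((cmod (f x + g x))\<^sup>2)
        \<le> norm (2 * (cmod (f x))\<^sup>2 + 2 * (cmod (g x))\<^sup>2)"
      by auto
  qed measurable
  then show ?thesis by (auto simp: sq_integrable_def)
qed

lemma sq_integrable_scale:
  "f \<in> sq_integrable M \<Longrightarrow> (\<lambda>x. a * f x) \<in> sq_integrable M"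
  by (auto simp: sq_integrable_def norm_mult power_mult_distrib)

lemma L2_add_class:
  assumes "f \<in> sq_integrable M" "g \<in> sq_integrable M"
  shows "L2_add M (L2_class M f) (L2_class M g) = L2_class M (\<lambda>x. f x + g x)"
proof -
  have "AE x in M. rep (L2_class M f) x + rep (L2_class M g) x = f x + g x"
    using AE_rep_L2_class[OF assms(1)] AE_rep_L2_class[OF assms(2)] by eventually_elim simp
  then show ?thesis
    unfolding L2_add_def using assms
    by (subst L2_class_eq_iff)
      (auto intro!: sq_integrable_add rep_sq_integrable L2_class_in_L2)
qed

lemma L2_scale_class:
  assumes "f \<in> sq_integrable M"
  shows "L2_scale M a (L2_class M f) = L2_class M (\<lambda>x. a * f x)"
proof -
  have "AE x in M. a * rep (L2_class M f) x = a * f x"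
    using AE_rep_L2_class[OF assms] by eventually_elim simp
  then show ?thesis
    unfolding L2_scale_def using assms
    by (subst L2_class_eq_iff)
      (auto intro!: sq_integrable_scale rep_sq_integrable L2_class_in_L2)
qed

lemma mult_op_class:
  assumes "f \<in> sq_integrable M" "\<phi> \<in> borel_measurable M" "(\<lambda>x. \<phi> x * f x) \<in> sq_integrable M"
  shows "mult_op M \<phi> (L2_class M f) = L2_class M (\<lambda>x. \<phi> x * f x)"
proof -
  have ae: "AE x in M. \<phi> x * rep (L2_class M f) x = \<phi> x * f x"
    using AE_rep_L2_class[OF assms(1)] by eventually_elim simp
  have [measurable]: "rep (L2_class M f) \<in> borel_measurable M" "\<phi> \<in> borel_measurable M"
    using rep_sq_integrable[OF L2_class_in_L2[OF assms(1)]] assms(2)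
    by (auto simp: sq_integrable_def)
  have "(\<lambda>x. \<phi> x * rep (L2_class M f) x) \<in> sq_integrable M"
    by (rule sq_integrable_cong[OF assms(3) _ ae]) measurable
  then show ?thesis
    using ae assms by (simp add: mult_op_def L2_class_in_L2 L2_class_eq_iff)
qed

lemma L2_inner_class:
  assumes "f \<in> sq_integrable M" "g \<in> sq_integrable M"
  shows "L2_inner M (L2_class M f) (L2_class M g) = (LINT x|M. cnj (f x) * g x)"
  unfolding L2_inner_def
proof (rule integral_cong_AE)
  show "AE x in M. cnj (rep (L2_class M f) x) * rep (L2_class M g) x = cnj (f x) * g x"
    using AE_rep_L2_class[OF assms(1)] AE_rep_L2_class[OF assms(2)] by eventually_elim simp
qed (auto intro!: borel_measurable_integrable sq_integrable_mult_cnj assms rep_sq_integrable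
       L2_class_in_L2)

lemma L2_inner_eqD:
  assumes F: "F \<in> L2 M" and F': "F' \<in> L2 M"
    and eq: "\<And>G. G \<in> L2 M \<Longrightarrow> L2_inner M F G = L2_inner M F' G"
  shows "F = F'"
proof -
  define f f' where "f = rep F" and "f' = rep F'"
  have f: "f \<in> sq_integrable M" "f' \<in> sq_integrable M"
    using F F' rep_sq_integrable by (auto simp: f_def f'_def)
  define d where "d = (\<lambda>x. f x - f' x)"
  have d: "d \<in> sq_integrable M"
    using sq_integrable_add[OF f(1) sq_integrable_scale[OF f(2), of "-1"]] by (simp add: d_def)
  have "(LINT x|M. cnj (f x) * d x) = (LINT x|M. cnj (f' x) * d x)"
    using eq[OF L2_class_in_L2[OF d]] L2_inner_class[OF f(1) d] L2_inner_class[OF f(2) d]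
      L2_class_rep[OF F] L2_class_rep[OF F'] by (simp add: f_def f'_def)
  then have "0 = (LINT x|M. cnj (f x) * d x - cnj (f' x) * d x)"
    using sq_integrable_mult_cnj[OF f(1) d] sq_integrable_mult_cnj[OF f(2) d] by simp
  also have "\<dots> = (LINT x|M. complex_of_real ((cmod (d x))\<^sup>2))"
    by (intro Bochner_Integration.integral_cong refl)
      (subst complex_norm_square, simp add: d_def algebra_simps)
  finally have "(LINT x|M. (cmod (d x))\<^sup>2) = 0"
    by (simp only: integral_complex_of_real) simp
  moreover have "integrable M (\<lambda>x. (cmod (d x))\<^sup>2)"
    using d by (simp add: sq_integrable_def)
  ultimately have "AE x in M. (cmod (d x))\<^sup>2 = 0"
    by (subst (asm) integral_nonneg_eq_0_iff_AE) auto
  then have "AE x in M. f x = f' x"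
    by (simp add: d_def)
  then have "L2_class M f = L2_class M f'"
    using f by (simp add: L2_class_eq_iff)
  then show ?thesis
    using L2_class_rep[OF F] L2_class_rep[OF F'] by (simp add: f_def f'_def)
qed

lemma is_adjoint_unique:
  assumes B: "is_adjoint M A B" and C: "is_adjoint M A C"
  shows "B = C"
proof (rule PiE_ext)
  show "B \<in> L2 M \<rightarrow>\<^sub>E L2 M" "C \<in> L2 M \<rightarrow>\<^sub>E L2 M"
    using B C by (auto simp: is_adjoint_def)
  show "B F = C F" if "F \<in> L2 M" for F
    using that B C by (intro L2_inner_eqD[of _ M]) (auto simp: is_adjoint_def)
qed

lemma L2_adjoint_eq: "is_adjoint M A B \<Longrightarrow> L2_adjoint M A = B"
  unfolding L2_adjoint_def by (rule the_equality) (auto intro: is_adjoint_unique)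

end

theory Submission
  imports Defs
begin

text \<open>
  If \<open>H\<close> commuted with its adjoint \<open>\<Omega> + |h\<rangle>\<langle>g|\<close>, evaluating \<open>H H\<^sup>* - H\<^sup>* H\<close> at \<open>g\<close> and dividing by
  \<open>g\<close>, which equals \<open>-h\<close> on \<open>]1,c[\<close> and \<open>h\<close> on \<open>]-c,-1[\<close>, would show that
  \<open>y (\<langle>g|g\<rangle> + \<langle>h|g\<rangle>)\<close> is constant on the first interval and \<open>y (\<langle>g|g\<rangle> - \<langle>h|g\<rangle>)\<close> on the second one.
  Hence both coefficients vanish, so \<open>\<langle>g|g\<rangle> = 0\<close>, which is absurd.
\<close>

section \<open>Bounded multiplication plus a rank one operator\<close>

lemma sq_integrable_bounded_mult:
  assumes f: "f \<in> sq_integrable M" and \<phi>: "\<phi> \<in> borel_measurable M"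
    and B: "\<And>x. x \<in> space M \<Longrightarrow> cmod (\<phi> x) \<le> B"
  shows "(\<lambda>x. \<phi> x * f x) \<in> sq_integrable M"
proof -
  have [measurable]: "f \<in> borel_measurable M" "\<phi> \<in> borel_measurable M"
    using f \<phi> by (auto simp: sq_integrable_def)
  have "integrable M (\<lambda>x. (cmod (\<phi> x * f x))\<^sup>2)"
  proof (rule Bochner_Integration.integrable_bound)
    show "integrable M (\<lambda>x. B\<^sup>2 * (cmod (f x))\<^sup>2)"
      using f by (auto simp: sq_integrable_def)
    show "AE x in M. norm ((cmod (\<phi> x * f x))\<^sup>2) \<le> norm (B\<^sup>2 * (cmod (f x))\<^sup>2)"
      by (auto simp: norm_mult power_mult_distrib intro!: AE_I2 mult_right_mono power_mono B)
  qed measurable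
  then show ?thesis by (auto simp: sq_integrable_def)
qed

text \<open>Turns every later operator computation into one on functions, so that the choice inside
  \<open>rep\<close> no longer appears. The bound on \<open>\<phi>\<close> keeps
  \<open>\<phi> x * f x\<close> square integrable.\<close>

lemma mult_plus_ketbra_class:
  assumes u: "u \<in> sq_integrable M" and v: "v \<in> sq_integrable M" and f: "f \<in> sq_integrable M"
    and \<phi>: "\<phi> \<in> borel_measurable M" and B: "\<And>x. x \<in> space M \<Longrightarrow> cmod (\<phi> x) \<le> B"
  shows "op_add M (mult_op M \<phi>) (ketbra M (L2_class M u) (L2_class M v)) (L2_class M f) =
    L2_class M (\<lambda>x. \<phi> x * f x + (LINT y|M. cnj (v y) * f y) * u x)"
  using sq_integrable_bounded_mult[OF f \<phi> B] assms
  by (simp add: op_add_def ketbra_def L2_class_in_L2 mult_op_class L2_inner_class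
      L2_scale_class L2_add_class sq_integrable_scale)

text \<open>Taking adjoints conjugates the multiplier and swaps the two vectors of the rank one
  part. With uniqueness of adjoints, this identifies the description operator in
  \<open>L2_adjoint\<close>.\<close>

lemma is_adjoint_mult_plus_ketbra:
  assumes u: "u \<in> sq_integrable M" and v: "v \<in> sq_integrable M"
    and \<phi>: "\<phi> \<in> borel_measurable M" and B: "\<And>x. x \<in> space M \<Longrightarrow> cmod (\<phi> x) \<le> B"
  shows "is_adjoint M (op_add M (mult_op M \<phi>) (ketbra M (L2_class M u) (L2_class M v)))
    (op_add M (mult_op M (\<lambda>x. cnj (\<phi> x))) (ketbra M (L2_class M v) (L2_class M u)))"
    (is "is_adjoint M ?A ?B")
  unfolding is_adjoint_def
proof (intro conjI ballI)
  have [measurable]: "cnj \<in> borel_measurable borel"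
    by (intro borel_measurable_continuous_onI continuous_intros)
  have \<phi>': "(\<lambda>x. cnj (\<phi> x)) \<in> borel_measurable M"
    using \<phi> by measurable
  have B': "cmod (cnj (\<phi> x)) \<le> B" if "x \<in> space M" for x
    using B[OF that] by simp
  have sq: "(\<lambda>x. \<psi> x * f x + a * w x) \<in> sq_integrable M"
    if "\<psi> \<in> borel_measurable M" "\<And>x. x \<in> space M \<Longrightarrow> cmod (\<psi> x) \<le> B"
      "f \<in> sq_integrable M" "w \<in> sq_integrable M" for \<psi> f w a
    using that by (intro sq_integrable_add sq_integrable_bounded_mult sq_integrable_scale)
  have ex: "\<exists>f. f \<in> sq_integrable M \<and> F = L2_class M f" if "F \<in> L2 M" for F
    using rep_sq_integrable[OF that] L2_class_rep[OF that] by metis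
  show "?B \<in> L2 M \<rightarrow>\<^sub>E L2 M"
  proof (rule PiE_I)
    fix F assume "F \<in> L2 M"
    then obtain f where "f \<in> sq_integrable M" "F = L2_class M f"
      using ex by blast
    then show "?B F \<in> L2 M"
      using mult_plus_ketbra_class[OF v u _ \<phi>' B'] sq[OF \<phi>' B' _ v]
      by (simp add: L2_class_in_L2)
  qed (simp add: op_add_def)
  fix F G assume "F \<in> L2 M" "G \<in> L2 M"
  then obtain f k where f: "f \<in> sq_integrable M" and F: "F = L2_class M f"
    and k: "k \<in> sq_integrable M" and G: "G = L2_class M k"
    using ex by metis
  define a b where "a = (LINT x|M. cnj (u x) * f x)" and "b = (LINT x|M. cnj (v x) * k x)"
  \<comment> \<open>The coefficient \<open>a\<close> sits in the conjugate-linear slot of the inner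
    product, so it comes out as \<open>cnj a\<close>, which is the inner product of \<open>f\<close>
    with \<open>u\<close>.\<close>
  have cnj_a: "cnj a = (LINT x|M. cnj (f x) * u x)"
    unfolding a_def Bochner_Integration.integral_cnj[symmetric]
    by (simp only: complex_cnj_mult complex_cnj_cnj mult.commute)
  note int = sq_integrable_mult_cnj[OF f sq_integrable_bounded_mult[OF k \<phi> B]]
    sq_integrable_mult_cnj[OF f u] sq_integrable_mult_cnj[OF v k]
  have A_G: "?A G = L2_class M (\<lambda>x. \<phi> x * k x + b * u x)"
    unfolding G b_def by (rule mult_plus_ketbra_class[OF u v k \<phi> B])
  have B_F: "?B F = L2_class M (\<lambda>x. cnj (\<phi> x) * f x + a * v x)"
    unfolding F a_def by (rule mult_plus_ketbra_class[OF v u f \<phi>' B'])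
  have "L2_inner M (?B F) G = (LINT x|M. cnj (cnj (\<phi> x) * f x + a * v x) * k x)"
    unfolding B_F G by (rule L2_inner_class[OF sq[OF \<phi>' B' f v] k])
  also have "\<dots> = (LINT x|M. cnj (f x) * (\<phi> x * k x) + cnj a * (cnj (v x) * k x))"
    by (simp add: algebra_simps)
  also have "\<dots> = (LINT x|M. cnj (f x) * (\<phi> x * k x)) + cnj a * b"
    using int by (simp add: b_def)
  \<comment> \<open>The product \<open>cnj a * b\<close> is read the other way round:
    \<open>b\<close> stays a constant and \<open>cnj a\<close> is expanded, which moves the rank one
    part onto \<open>k\<close>.\<close>
  also have "\<dots> = (LINT x|M. cnj (f x) * (\<phi> x * k x) + b * (cnj (f x) * u x))"
    using int by (simp add: cnj_a)
  also have "\<dots> = (LINT x|M. cnj (f x) * (\<phi> x * k x + b * u x))"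
    by (simp add: algebra_simps)
  also have "\<dots> = L2_inner M F (?A G)"
    unfolding A_G F by (rule L2_inner_class[OF f sq[OF \<phi> B k u], symmetric])
  finally show "L2_inner M (?B F) G = L2_inner M F (?A G)" .
qed

text \<open>Both products of the operator and its adjoint, applied to \<open>f\<close>, contain the
  same term \<open>\<phi>\<close> squared times \<open>f\<close>. It cancels, leaving a relation
  between multiples of \<open>u\<close> and \<open>v\<close> only. The values of \<open>p\<close>
  and \<open>q\<close> do not matter later, hence the existential.\<close>

lemma normal_mult_plus_ketbra_AE:
  assumes u: "u \<in> sq_integrable M" and v: "v \<in> sq_integrable M" and f: "f \<in> sq_integrable M"
    and \<phi>: "\<phi> \<in> borel_measurable M" and B: "\<And>x. x \<in> space M \<Longrightarrow> cmod (\<phi> x) \<le> B"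
    and real: "\<And>x. cnj (\<phi> x) = \<phi> x"
    and normal: "normal_op M (op_add M (mult_op M \<phi>) (ketbra M (L2_class M u) (L2_class M v)))"
  shows "\<exists>p q. AE x in M.
    \<phi> x * ((LINT y|M. cnj (u y) * f y) * v x - (LINT y|M. cnj (v y) * f y) * u x)
      = p * u x + q * v x"
proof -
  let ?A = "op_add M (mult_op M \<phi>) (ketbra M (L2_class M u) (L2_class M v))"
  let ?B = "op_add M (mult_op M \<phi>) (ketbra M (L2_class M v) (L2_class M u))"
  have adj: "L2_adjoint M ?A = ?B"
    using L2_adjoint_eq[OF is_adjoint_mult_plus_ketbra[OF u v \<phi> B]] by (simp add: real)
  have sq: "(\<lambda>x. \<phi> x * k x + a * w x) \<in> sq_integrable M"
    if "k \<in> sq_integrable M" "w \<in> sq_integrable M" for k w a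
    using that \<phi> B by (intro sq_integrable_add sq_integrable_bounded_mult sq_integrable_scale)
  have A: "?A (L2_class M k) = L2_class M (\<lambda>x. \<phi> x * k x + (LINT y|M. cnj (v y) * k y) * u x)"
    and B: "?B (L2_class M k) = L2_class M (\<lambda>x. \<phi> x * k x + (LINT y|M. cnj (u y) * k y) * v x)"
    if "k \<in> sq_integrable M" for k
    using mult_plus_ketbra_class[OF u v that \<phi> B] mult_plus_ketbra_class[OF v u that \<phi> B] by auto
  define a b where "a = (LINT y|M. cnj (u y) * f y)" and "b = (LINT y|M. cnj (v y) * f y)"
  \<comment> \<open>\<open>s\<close> and \<open>t\<close> are the rank one coefficients of the outer
    operator: \<open>v\<close> paired with \<open>?B\<close> of \<open>f\<close>, and
    \<open>u\<close> paired with \<open>?A\<close> of \<open>f\<close>.\<close>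
  define s where "s = (LINT y|M. cnj (v y) * (\<phi> y * f y + a * v y))"
  define t where "t = (LINT y|M. cnj (u y) * (\<phi> y * f y + b * u y))"
  have "?A (?B (L2_class M f)) = ?B (?A (L2_class M f))"
    using fun_cong[OF normal[unfolded normal_op_def adj], of "L2_class M f"] f
    by (simp add: compose_def L2_class_in_L2)
  then have "L2_class M (\<lambda>x. \<phi> x * (\<phi> x * f x + a * v x) + s * u x) =
      L2_class M (\<lambda>x. \<phi> x * (\<phi> x * f x + b * u x) + t * v x)"
    unfolding A[OF f] B[OF f] a_def[symmetric] b_def[symmetric]
      A[OF sq[OF f v]] B[OF sq[OF f u]] s_def[symmetric] t_def[symmetric] .
  then have "AE x in M. \<phi> x * (\<phi> x * f x + a * v x) + s * u x =
      \<phi> x * (\<phi> x * f x + b * u x) + t * v x"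
    using L2_class_eq_iff[OF sq[OF sq[OF f v] u] sq[OF sq[OF f u] v]] by blast
  then have "AE x in M. \<phi> x * (a * v x - b * u x) = - s * u x + t * v x"
    by eventually_elim (simp add: algebra_simps)
  then show ?thesis
    unfolding a_def b_def by blast
qed

section \<open>Almost everywhere identities on intervals and square integrability\<close>

text \<open>If \<open>s\<close> were nonzero, the equation would have at most one real solution,
  whereas a nonempty open interval has positive measure.\<close>

lemma AE_interval_affine_imp_zero:
  fixes s t :: complex
  assumes ae: "AE x in lebesgue_on G. x \<in> {a<..<b} \<longrightarrow> complex_of_real x * s = t"
    and G: "G \<in> sets lebesgue" and sub: "{a<..<b} \<subseteq> G" and ab: "a < b"
  shows "s = 0"
proof (rule ccontr)
  assume s: "s \<noteq> 0"
  have "AE x in lebesgue. x \<in> G \<longrightarrow> x \<in> {a<..<b} \<longrightarrow> complex_of_real x * s = t"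
    using ae G by (subst (asm) AE_restrict_space_iff) auto
  \<comment> \<open>The quotient \<open>t / s\<close> may fail to be real; any real solution must
    still equal its real part.\<close>
  moreover have "AE x in lebesgue. x \<noteq> Re (t / s)"
    by (rule AE_I'[of "{Re (t / s)}"]) auto
  ultimately have "AE x in lebesgue. x \<notin> {a<..<b}"
  proof eventually_elim
    case (elim x)
    have "x = Re (t / s)" if "complex_of_real x * s = t"
      using that s by auto
    then show ?case using elim sub by blast
  qed
  then have "{a<..<b} \<in> null_sets lebesgue"
    by (subst AE_iff_null_sets) auto
  then show False
    using ab by (auto simp: null_sets_def)
qed

lemma smooth_imp_continuous_on:
  assumes "smooth f"
  shows "continuous_on S f"
proof (intro continuous_at_imp_continuous_on ballI)
  fix x
  have "(deriv ^^ 0) f differentiable (at x)"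
    using assms[unfolded smooth_def, rule_format, of 0 x] .
  then show "isCont f x"
    by (simp add: differentiable_imp_continuous_within)
qed

text \<open>A continuous function is bounded on the compact closure of \<open>G\<close>, and bounded
  measurable functions are square integrable for a finite measure.\<close>

lemma continuous_imp_sq_integrable_lebesgue_on:
  fixes f :: "real \<Rightarrow> complex"
  assumes f: "continuous_on UNIV f" and G: "G \<in> lmeasurable" "bounded G"
  shows "f \<in> sq_integrable (lebesgue_on G)"
proof -
  have meas: "f \<in> borel_measurable (lebesgue_on G)"
    by (simp add: borel_measurable_continuous_onI f measurable_completion measurable_restrict_space1)
  have "bounded (f ` closure G)"
    using f G(2)
    by (intro compact_imp_bounded compact_continuous_image) (auto intro: continuous_on_subset)
  then obtain B where "\<forall>y \<in> f ` closure G. cmod y \<le> B"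
    unfolding bounded_iff ..
  then have B: "cmod (f x) \<le> B" if "x \<in> G" for x
    using subsetD[OF closure_subset that] by simp
  interpret finite_measure "lebesgue_on G"
    using G(1) by (rule finite_measure_lebesgue_on)
  have "integrable (lebesgue_on G) (\<lambda>x. (cmod (f x))\<^sup>2)"
    using meas B by (intro integrable_const_bound[of _ "B\<^sup>2"])
      (auto intro!: AE_I2 power_mono)
  then show ?thesis
    using meas by (simp add: sq_integrable_def)
qed

section \<open>Failure of normality for \<open>H\<close>\<close>

theorem proposition2p1:
  fixes c :: real and G :: "real set" and M :: "real measure"
    and g h :: "real \<Rightarrow> real"
    and \<Omega> H :: "(real \<Rightarrow> complex) set \<Rightarrow> (real \<Rightarrow> complex) set"
  assumes "c > 1"
    and G: "G = {-c<..<-1} \<union> {1<..<c}"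
    and "smooth g" and "smooth h"
    and "\<And>x. x \<in> G \<Longrightarrow> g x > 0"
    and "\<And>x. x \<notin> G \<Longrightarrow> g x = 0"
    and "\<And>y. g y = g (- y)"
    and "\<And>y. y > 1 \<Longrightarrow> h y = - g y"
    and "\<And>y. y < -1 \<Longrightarrow> h y = g y"
    and "\<And>y. \<bar>y\<bar> \<le> 1 \<Longrightarrow> h y = 0"
    and M: "M = lebesgue_on G"
    and \<Omega>: "\<Omega> = mult_op M complex_of_real"
    and H: "H = op_add M \<Omega>
                 (ketbra M (L2_class M (\<lambda>x. complex_of_real (g x)))
                           (L2_class M (\<lambda>x. complex_of_real (h x))))"
  shows "\<not> normal_op M H"
proof
  assume normal: "normal_op M H"
  let ?g = "\<lambda>x. complex_of_real (g x)" and ?h = "\<lambda>x. complex_of_real (h x)"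
  have G_lm: "G \<in> lmeasurable" "bounded G"
    unfolding G by (auto intro!: fmeasurable.Un)
  have G_sets: "G \<in> sets lebesgue"
    using G_lm by blast
  have space: "space M = G"
    by (simp add: M)
  have sq: "?g \<in> sq_integrable M" "?h \<in> sq_integrable M"
    unfolding M using smooth_imp_continuous_on[OF \<open>smooth g\<close>] smooth_imp_continuous_on[OF \<open>smooth h\<close>]
    by (auto intro!: continuous_imp_sq_integrable_lebesgue_on G_lm continuous_intros)
  have "complex_of_real \<in> borel_measurable borel"
    by (intro borel_measurable_continuous_onI continuous_intros)
  then have meas: "complex_of_real \<in> borel_measurable M"
    unfolding M by (simp add: measurable_completion measurable_restrict_space1)
  have bound: "cmod (complex_of_real x) \<le> c" if "x \<in> space M" for x
    using that by (auto simp: space G)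
  define a b where "a = (LINT x|M. cnj (?g x) * ?g x)" and "b = (LINT x|M. cnj (?h x) * ?g x)"
  \<comment> \<open>The test vector is \<open>g\<close> itself, so the two coefficients are the
    pairings \<open>a\<close> and \<open>b\<close> of \<open>g\<close> and \<open>h\<close> with
    \<open>g\<close>.\<close>
  obtain p q where pq: "AE x in M. complex_of_real x * (a * ?h x - b * ?g x) = p * ?g x + q * ?h x"
    using normal_mult_plus_ketbra_AE[OF sq sq(1) meas bound] normal
    unfolding H \<Omega> a_def b_def by auto
  have ae: "AE x in M. x \<in> G"
    using AE_space[of M] by (simp add: space)
  have "a + b = 0"
  proof (rule AE_interval_affine_imp_zero[where G = G and a = 1 and b = c and t = "q - p"])
    show "AE x in lebesgue_on G. x \<in> {1<..<c} \<longrightarrow> complex_of_real x * (a + b) = q - p"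
      using pq ae unfolding M[symmetric]
    proof eventually_elim
      case (elim x)
      show ?case
      proof
        assume "x \<in> {1<..<c}"
        then have "?h x = - ?g x" "?g x \<noteq> 0"
          using assms(5)[OF elim(2)] assms(8)[of x] by auto
        \<comment> \<open>Substituting \<open>h = -g\<close> turns both sides of \<open>pq\<close>
          into multiples of \<open>g\<close> with reversed sign; the nonzero factor
          \<open>g x\<close> then cancels.\<close>
        moreover have "?g x * (complex_of_real x * (a + b)) = ?g x * (q - p)"
        proof -
          have "?g x * (complex_of_real x * (a + b)) =
              - (complex_of_real x * (a * ?h x - b * ?g x))"
            unfolding \<open>?h x = - ?g x\<close> by (simp only: algebra_simps) simp
          also have "\<dots> = - (p * ?g x + q * ?h x)"
            by (simp only: elim(1))
          also have "\<dots> = ?g x * (q - p)"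
            unfolding \<open>?h x = - ?g x\<close> by (simp add: algebra_simps)
          finally show ?thesis .
        qed
        ultimately show "complex_of_real x * (a + b) = q - p"
          by simp
      qed
    qed
  qed (use \<open>c > 1\<close> G G_sets in auto)
  moreover have "a - b = 0"
  proof (rule AE_interval_affine_imp_zero[where G = G and a = "-c" and b = "-1" and t = "p + q"])
    show "AE x in lebesgue_on G. x \<in> {-c<..<-1} \<longrightarrow> complex_of_real x * (a - b) = p + q"
      using pq ae unfolding M[symmetric]
    proof eventually_elim
      case (elim x)
      show ?case
      proof
        assume "x \<in> {-c<..<-1}"
        then have "?h x = ?g x" "?g x \<noteq> 0"
          using assms(5)[OF elim(2)] assms(9)[of x] by auto
        moreover have "?g x * (complex_of_real x * (a - b)) = ?g x * (p + q)"
          using elim(1) unfolding \<open>?h x = ?g x\<close> by (simp only: algebra_simps)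
        ultimately show "complex_of_real x * (a - b) = p + q"
          by simp
      qed
    qed
  qed (use \<open>c > 1\<close> G G_sets in auto)
  \<comment> \<open>Adding the two relations gives \<open>2 * a = 0\<close>.\<close>
  ultimately have "a = 0"
    by (simp add: add_eq_0_iff)
  moreover have "a = complex_of_real (LINT x|M. (g x)\<^sup>2)"
    unfolding a_def by (subst integral_complex_of_real[symmetric]) (simp add: power2_eq_square)
  ultimately have "(LINT x|M. (g x)\<^sup>2) = 0"
    by simp
  moreover have "integrable M (\<lambda>x. (g x)\<^sup>2)"
    using sq(1) by (simp add: sq_integrable_def)
  ultimately have "AE x in M. (g x)\<^sup>2 = 0"
    by (subst (asm) integral_nonneg_eq_0_iff_AE) auto
  \<comment> \<open>Positivity of \<open>g\<close> on \<open>G\<close> makes this contradictory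
    pointwise. The false equation is written with \<open>s = 1\<close> and \<open>t = 0\<close> so
    that the interval lemma yields \<open>1 = 0\<close>.\<close>
  then have "AE x in lebesgue_on G. x \<in> {1<..<c} \<longrightarrow> complex_of_real x * 1 = 0"
    using ae unfolding M[symmetric]
  proof eventually_elim
    case (elim x)
    then show ?case using assms(5)[OF elim(2)] by simp
  qed
  then show False
    using AE_interval_affine_imp_zero[where G = G and a = 1 and b = c and s = 1 and t = 0] \<open>c > 1\<close> G G_sets by auto
qed

end
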